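(* Let $\mathbb{G}_\infty$, $F$ and $h$ be as in the context and let $t\in[0,1]$. For every complex $s$ with $\operatorname{Re}(s)>2$ the series $$Z(s,t):=\sum_{\sigma\in\mathbb{G}_\infty}\exp\bigl(2\pi i t(1-F(\sigma))\bigr)\,h(\sigma)^{-s}$$ is (absolutely) summable. Moreover, for $\operatorname{Re}(s)>2$, $$Z(s,1)=\sum_{\sigma\in\mathbb{G}_\infty}\exp(-2\pi i F(\sigma))\,h(\sigma)^{-s}=\frac{1}{\zeta(s)}\quad\text{and}\quad Z(s,0)=\sum_{\sigma\in\mathbb{G}_\infty}h(\sigma)^{-s}=\frac{\zeta(s-1)}{\zeta(s)},$$ where $\zeta$ is the Riemann zeta function.
   Context: For $k\in\mathbb{N}_0$ let $\mathbb{G}_k=(\mathbb{Z}/2\mathbb{Z})^k$, elements $\sigma=(\sigma_1,\dots,\sigma_k)$ with $\sigma_i\in\{0,1\}$. Define $\hat h_k,\hat r_k:\{0,\dots,2^k\}\to\mathbb{N}_0$ recursively by $\hat h_0(0)=\hat h_0(1)=1$, $\hat r_0(0)=0$, $\hat r_0(1)=1$, and for $s\in\{0,\dots,2^k\}$: $\hat h_{k+1}(2s)=\hat h_k(s)$, $\hat r_{k+1}(2s)=\hat r_k(s)$; for $s\in\{0,\dots,2^k-1\}$: $\hat h_{k+1}(2s+1)=\hat h_k(s)+\hat h_k(s+1)$, $\hat r_{k+1}(2s+1)=\hat r_k(s)+\hat r_k(s+1)$. For $\sigma\in\mathbb{G}_k$ put $s=\sum_{i=1}^k\sigma_i2^{k-i}$,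 $h_k(\sigma)=\hat h_k(s)$, $F_k(\sigma)=\hat r_k(s)/\hat h_k(s)$. Let $\mathbb{G}_\infty=\bigoplus_{\mathbb{N}}\mathbb{Z}/2\mathbb{Z}$ (0/1-sequences $(\sigma_i)_{i\ge1}$ with finitely many nonzero entries). For $\sigma\in\mathbb{G}_\infty$ define $F(\sigma)=F_k(\sigma_1,\dots,\sigma_k)$ and $h(\sigma)=h_k(\sigma_1,\dots,\sigma_k)$ for any $k$ with $\sigma_i=0$ for all $i>k$ (this is independent of $k$). *)

theory Defs
  imports "HOL-Analysis.Analysis" "HOL-Library.Z2"
begin

text \<open>
  The recursions are only meaningful for arguments in \<open>{0..2^k}\<close>; outside this range
  the values are irrelevant. The even and odd clauses are given separately in
  \<open>hhat_even\<close>, \<open>hhat_odd\<close>, \<open>rhat_even\<close>, \<open>rhat_odd\<close> below.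
\<close>

primrec hhat :: "nat \<Rightarrow> nat \<Rightarrow> nat" where
  "hhat 0 s = 1"
| "hhat (Suc k) s =
     (if even s then hhat k (s div 2) else hhat k (s div 2) + hhat k (s div 2 + 1))"

primrec rhat :: "nat \<Rightarrow> nat \<Rightarrow> nat" where
  "rhat 0 s = (if s = 0 then 0 else 1)"
| "rhat (Suc k) s =
     (if even s then rhat k (s div 2) else rhat k (s div 2) + rhat k (s div 2 + 1))"

lemma hhat_even: "hhat (Suc k) (2 * s) = hhat k s"
  and hhat_odd: "hhat (Suc k) (2 * s + 1) = hhat k s + hhat k (s + 1)"
  and rhat_even: "rhat (Suc k) (2 * s) = rhat k s"
  and rhat_odd: "rhat (Suc k) (2 * s + 1) = rhat k s + rhat k (s + 1)"
  by simp_all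

text \<open>
  A finite word in \<open>(\<int>/2\<int>)^k\<close> is represented by any sequence indexed by \<open>nat\<close> whose entries at
  \<open>1, \<dots>, k\<close> are the entries of the word; no other entry is used.
\<close>

definition code :: "nat \<Rightarrow> (nat \<Rightarrow> bit) \<Rightarrow> nat" where
  "code k \<sigma> = (\<Sum>i=1..k. of_bit (\<sigma> i) * 2 ^ (k - i))"

definition h_level :: "nat \<Rightarrow> (nat \<Rightarrow> bit) \<Rightarrow> nat" where
  "h_level k \<sigma> = hhat k (code k \<sigma>)"

definition F_level :: "nat \<Rightarrow> (nat \<Rightarrow> bit) \<Rightarrow> real" where
  "F_level k \<sigma> = real (rhat k (code k \<sigma>)) / real (hhat k (code k \<sigma>))"

text \<open>
  Sequences are indexed from 1, so the unused entry at index 0 is fixed to be 0 in order to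
  count every sequence exactly once.
\<close>

definition G_inf :: "(nat \<Rightarrow> bit) set" where
  "G_inf = {\<sigma>. \<sigma> 0 = 0 \<and> finite {i. \<sigma> i \<noteq> 0}}"

definition level :: "(nat \<Rightarrow> bit) \<Rightarrow> nat" where
  "level \<sigma> = (LEAST k. \<forall>i>k. \<sigma> i = 0)"

definition h :: "(nat \<Rightarrow> bit) \<Rightarrow> nat" where
  "h \<sigma> = h_level (level \<sigma>) \<sigma>"

definition F :: "(nat \<Rightarrow> bit) \<Rightarrow> real" where
  "F \<sigma> = F_level (level \<sigma>) \<sigma>"

lemma code_Suc: "code (Suc k) \<sigma> = 2 * code k \<sigma> + of_bit (\<sigma> (Suc k))"
proof -
  have "(\<Sum>i=1..k. of_bit (\<sigma> i) * 2 ^ (Suc k - i)) = (\<Sum>i=1..k. 2 * (of_bit (\<sigma> i) * 2 ^ (k - i)) :: nat)"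
    by (rule sum.cong) (auto simp: Suc_diff_le)
  then show ?thesis
    by (simp add: code_def sum_distrib_left del: sum_mult_of_bool_eq sum_of_bool_mult_eq)
qed

lemma level_indep:
  assumes "\<forall>i>m. \<sigma> i = 0" "m \<le> k"
  shows "h_level k \<sigma> = h_level m \<sigma>" "F_level k \<sigma> = F_level m \<sigma>"
proof -
  have "h_level k \<sigma> = h_level m \<sigma> \<and> F_level k \<sigma> = F_level m \<sigma>"
    using assms(2)
  proof (induction k rule: dec_induct)
    case (step n)
    have "code (Suc n) \<sigma> = 2 * code n \<sigma>"
      using assms(1) step(1) by (simp add: code_Suc)
    then have "h_level (Suc n) \<sigma> = h_level n \<sigma>" "F_level (Suc n) \<sigma> = F_level n \<sigma>"
      by (simp_all add: h_level_def F_level_def)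
    with step.IH show ?case
      by simp
  qed simp
  then show "h_level k \<sigma> = h_level m \<sigma>" "F_level k \<sigma> = F_level m \<sigma>"
    by simp_all
qed

lemma h_F_eq_level:
  assumes "\<forall>i>k. \<sigma> i = 0"
  shows "h \<sigma> = h_level k \<sigma>" "F \<sigma> = F_level k \<sigma>"
proof -
  have "\<forall>i>level \<sigma>. \<sigma> i = 0" "level \<sigma> \<le> k"
    using assms unfolding level_def by (rule LeastI, rule Least_le)
  from level_indep[OF this] show "h \<sigma> = h_level k \<sigma>" "F \<sigma> = F_level k \<sigma>"
    by (simp_all add: h_def F_def)
qed

definition Z_term :: "complex \<Rightarrow> real \<Rightarrow> (nat \<Rightarrow> bit) \<Rightarrow> complex" where
  "Z_term s t \<sigma> =
     exp (2 * complex_of_real pi * \<i> * complex_of_real t * (1 - complex_of_real (F \<sigma>)))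
       * of_nat (h \<sigma>) powr (- s)"

definition Z :: "complex \<Rightarrow> real \<Rightarrow> complex" where
  "Z s t = (\<Sum>\<^sub>\<infinity>\<sigma>\<in>G_inf. Z_term s t \<sigma>)"

text \<open>
  The Riemann zeta function on the half-plane \<open>Re s > 1\<close>, where it is given by its Dirichlet series
  (shifted by one because \<open>suminf\<close> starts at 0). Its analytic continuation is not covered:
  for other \<open>s\<close> the value is meaningless.
\<close>

definition riemann_zeta :: "complex \<Rightarrow> complex" where
  "riemann_zeta s = (\<Sum>n. of_nat (n + 1) powr (- s))"

lemma riemann_zeta_sums:
  assumes "Re s > 1"
  shows "(\<lambda>n. of_nat (n + 1) powr (- s)) sums riemann_zeta s"
proof -
  have "summable (\<lambda>n. norm (of_nat n powr (- s) :: complex))"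
    using assms by (simp add: norm_powr_real_powr summable_real_powr_iff)
  then have "summable (\<lambda>n. of_nat n powr (- s) :: complex)"
    by (rule summable_norm_cancel)
  then have "summable (\<lambda>n. of_nat (Suc n) powr (- s) :: complex)"
    by (subst summable_Suc_iff)
  then show ?thesis
    by (simp add: riemann_zeta_def summable_sums)
qed

end

theory Submission
  imports Defs
begin

text \<open>
  The pairs \<open>(rhat k s, hhat k s)\<close> with \<open>s < 2^k\<close> form the Stern--Brocot array, so
  \<open>\<sigma> \<mapsto> (h \<sigma> * F \<sigma>, h \<sigma>)\<close> is a bijection from \<open>G_inf\<close> onto the reduced fractions in \<open>[0,1)\<close>.
  Since every fraction \<open>a/N\<close> with \<open>0 \<le> a < N\<close> is uniquely \<open>m r / (m n)\<close> with \<open>r/n\<close> reduced,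
  multiplying \<open>Z s t\<close> by \<open>\<zeta>(s)\<close> gives the sum of
  \<open>exp (2 \<pi> i t (1 - a/N)) N powr (- s)\<close> over all such \<open>a\<close> and \<open>N\<close>. For \<open>t = 0\<close> this is
  \<open>\<Sum>N. N * N powr (- s) = \<zeta>(s - 1)\<close>; for \<open>t = 1\<close> the inner sum over \<open>a\<close> vanishes unless
  \<open>N = 1\<close>, and the total is 1, which also shows \<open>\<zeta>(s) \<noteq> 0\<close>.
\<close>

section \<open>The Stern--Brocot array\<close>

lemma hhat_pos: "hhat k s > 0"
  by (induction k arbitrary: s) auto

text \<open>Neighbouring columns have determinant one: a refinement replaces one column by the sum
  of both, which preserves the determinant. The additive form avoids truncated subtraction.\<close>

lemma rhat_hhat_det:
  "s < 2 ^ k \<Longrightarrow> rhat k (s + 1) * hhat k s = rhat k s * hhat k (s + 1) + 1"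
proof (induction k arbitrary: s)
  case (Suc k)
  define u where "u = s div 2"
  have "u < 2 ^ k"
    using Suc.prems by (auto simp: u_def)
  note IH = Suc.IH[OF this]
  show ?case
  proof (cases "even s")
    case True
    then have "s = 2 * u"
      by (simp add: u_def)
    then show ?thesis
      using IH by (simp add: algebra_simps)
  next
    case False
    then have "s = 2 * u + 1"
      by (simp add: u_def)
    then show ?thesis
      using IH by (simp add: algebra_simps)
  qed
qed simp

text \<open>A common divisor divides both products in the determinant identity, hence their
  difference 1.\<close>

lemma coprime_rhat_hhat:
  assumes "s < 2 ^ k"
  shows "coprime (rhat k s) (hhat k s)"
proof (rule coprimeI)
  fix d assume "d dvd rhat k s" "d dvd hhat k s"
  then have "d dvd rhat k (s + 1) * hhat k s" "d dvd rhat k s * hhat k (s + 1)"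
    by simp_all
  then show "is_unit d"
    unfolding rhat_hhat_det[OF assms] by (metis dvd_add_right_iff)
qed

text \<open>Determinant one makes each fraction smaller than its right neighbour; induction chains
  these inequalities. So within one level the value determines the position.\<close>

lemma rhat_div_hhat_less:
  "s < s' \<Longrightarrow> s' \<le> 2 ^ k \<Longrightarrow> real (rhat k s) / real (hhat k s) < real (rhat k s') / real (hhat k s')"
proof (induction s' rule: less_induct)
  case (less u)
  then obtain v where v: "u = Suc v"
    by (cases u) auto
  have "rhat k (v + 1) * hhat k v > rhat k v * hhat k (v + 1)"
    using rhat_hhat_det[of v k] less.prems v by simp
  then have "real (rhat k (v + 1)) * real (hhat k v) > real (rhat k v) * real (hhat k (v + 1))"
    by (metis of_nat_less_iff of_nat_mult)
  then have step: "real (rhat k v) / real (hhat k v) < real (rhat k u) / real (hhat k u)"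
    using hhat_pos[of k v] hhat_pos[of k u] v by (simp add: field_simps)
  show ?case
  proof (cases "s = v")
    case False
    then have "real (rhat k s) / real (hhat k s) < real (rhat k v) / real (hhat k v)"
      using less v by simp
    with step show ?thesis
      by linarith
  qed (use step in simp)
qed

lemma rhat_last: "rhat k (2 ^ k) = 1" "hhat k (2 ^ k) = 1"
  by (induction k) simp_all

lemma rhat_less_hhat:
  assumes "s < 2 ^ k"
  shows "rhat k s < hhat k s"
  using rhat_div_hhat_less[OF assms order.refl] hhat_pos[of k s] by (simp add: rhat_last)

text \<open>The subtractive Euclidean algorithm on the coefficients descends through the array.\<close>

lemma coprime_combination_in_array:
  assumes "coprime a b" "a > 0" "s < 2 ^ k"
  shows "\<exists>k' s'. s' < 2 ^ k' \<and> rhat k' s' = a * rhat k s + b * rhat k (s + 1)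
           \<and> hhat k' s' = a * hhat k s + b * hhat k (s + 1)"
  using assms
proof (induction "a + b" arbitrary: a b k s rule: less_induct)
  case less
  consider "b = 0" | "b > 0" "a = b" | "b > 0" "b < a" | "a < b"
    by linarith
  then show ?case
  proof cases
    case 1
    then show ?thesis
      using less.prems by (intro exI[of _ k] exI[of _ s]) simp
  next
    case 2
    then have "a = 1" "b = 1"
      using less.prems by simp_all
    then show ?thesis
      using \<open>s < 2 ^ k\<close> by (intro exI[of _ "Suc k"] exI[of _ "2 * s + 1"]) simp
  next
    \<comment> \<open>With \<open>d = a - b\<close> the combination is \<open>d\<close> times column
      \<open>s\<close> plus \<open>b\<close> times the mediant: the left half of the interval one
      level down. The coefficient sum drops by \<open>b\<close>.\<close>
    case 3
    then obtain d where d: "a = d + b" "d > 0"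
      by (metis add.commute less_imp_add_positive)
    have "coprime d b" "2 * s < 2 ^ Suc k"
      using less.prems d by (simp_all add: coprime_iff_gcd_eq_1 del: coprime_imp_gcd_eq_1)
    from less.hyps[OF _ this(1) d(2) this(2)] obtain k' s'
      where "s' < 2 ^ k'"
        "rhat k' s' = d * rhat (Suc k) (2 * s) + b * rhat (Suc k) (2 * s + 1)"
        "hhat k' s' = d * hhat (Suc k) (2 * s) + b * hhat (Suc k) (2 * s + 1)"
      using d 3 by (auto simp del: rhat.simps hhat.simps)
    then show ?thesis
      unfolding rhat_even rhat_odd hhat_even hhat_odd d(1)
      by (intro exI[of _ k'] exI[of _ s']) (simp add: algebra_simps)
  next
    \<comment> \<open>The mirror image: the mediant takes coefficient \<open>a\<close> and the right
      end \<open>b - a\<close>, so the descent goes to the right half.\<close>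
    case 4
    then obtain d where d: "b = a + d" "d > 0"
      by (metis less_imp_add_positive)
    have "coprime a d" "2 * s + 1 < 2 ^ Suc k"
      using less.prems d by (simp_all add: coprime_iff_gcd_eq_1 del: coprime_imp_gcd_eq_1)
    from less.hyps[OF _ this(1) \<open>a > 0\<close> this(2)] obtain k' s'
      where "s' < 2 ^ k'"
        "rhat k' s' = a * rhat (Suc k) (2 * s + 1) + d * rhat (Suc k) (2 * (s + 1))"
        "hhat k' s' = a * hhat (Suc k) (2 * s + 1) + d * hhat (Suc k) (2 * (s + 1))"
      using d less.prems by (auto simp del: rhat.simps hhat.simps)
    then show ?thesis
      unfolding rhat_even rhat_odd hhat_even hhat_odd d(1)
      by (intro exI[of _ k'] exI[of _ s']) (simp add: algebra_simps)
  qed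
qed

text \<open>Level 0 has the columns (0, 1) and (1, 1); the pair (r, n) is their combination with the
  coprime coefficients \<open>n - r\<close> and \<open>r\<close>.\<close>

lemma reduced_fraction_in_array:
  assumes "coprime r n" "r < n"
  shows "\<exists>k s. s < 2 ^ k \<and> rhat k s = r \<and> hhat k s = n"
proof -
  have "coprime (n - r) r"
    using assms by (metis coprime_iff_gcd_eq_1 gcd.commute gcd_diff1_nat less_imp_le)
  from coprime_combination_in_array[OF this, of 0 0] assms show ?thesis
    by simp
qed

section \<open>Words\<close>

lemma code_less: "code k \<sigma> < 2 ^ k"
proof (induction k)
  case (Suc k)
  then show ?case
    by (cases "odd (\<sigma> (Suc k))") (auto simp: code_Suc)
qed (simp add: code_def)

text \<open>Digits are recovered from the last one: parity gives entry \<open>Suc k\<close>, and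
  halving leaves the code of the first \<open>k\<close> entries.\<close>

lemma code_inj:
  "code k \<sigma> = code k \<tau> \<Longrightarrow> i \<in> {1..k} \<Longrightarrow> \<sigma> i = \<tau> i"
proof (induction k)
  case (Suc k)
  have eq: "2 * code k \<sigma> + of_bool (odd (\<sigma> (Suc k))) = 2 * code k \<tau> + of_bool (odd (\<tau> (Suc k)))"
    using Suc.prems(1) by (simp only: code_Suc)
  then have parity: "odd (\<sigma> (Suc k)) \<longleftrightarrow> odd (\<tau> (Suc k))"
    by (cases "odd (\<sigma> (Suc k))"; cases "odd (\<tau> (Suc k))"; simp only: of_bool_eq simp_thms; presburger)
  with eq have "code k \<sigma> = code k \<tau>"
    by simp
  moreover from parity have "\<sigma> (Suc k) = \<tau> (Suc k)"
    by (metis bit_not_one_iff dvd_0_right odd_one)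
  ultimately show ?case
    using Suc by (cases "i = Suc k") auto
qed simp

lemma code_fun_upd: "code k (\<sigma>(Suc k := b)) = code k \<sigma>"
  unfolding code_def by (intro sum.cong) auto

lemma code_surj:
  "s < 2 ^ k \<Longrightarrow> \<exists>\<sigma>. \<sigma> 0 = 0 \<and> (\<forall>i>k. \<sigma> i = 0) \<and> code k \<sigma> = s"
proof (induction k arbitrary: s)
  case 0
  then show ?case
    by (intro exI[of _ "\<lambda>_. 0"]) (simp add: code_def)
next
  case (Suc k)
  then have "s div 2 < 2 ^ k"
    by auto
  from Suc.IH[OF this] obtain \<sigma>
    where \<sigma>: "\<sigma> 0 = 0" "\<forall>i>k. \<sigma> i = 0" "code k \<sigma> = s div 2"
    by blast
  let ?\<tau> = "\<sigma>(Suc k := of_bool (odd s))"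
  have "code (Suc k) ?\<tau> = s"
    unfolding code_Suc code_fun_upd \<sigma>(3) by simp
  moreover have "?\<tau> 0 = 0" "\<forall>i>Suc k. ?\<tau> i = 0"
    using \<sigma> by simp_all
  ultimately show ?case
    by blast
qed

section \<open>The bijection between \<open>G_inf\<close> and the reduced fractions\<close>

lemma G_inf_bounded:
  assumes "\<sigma> \<in> G_inf"
  obtains k where "\<forall>i>k. \<sigma> i = 0"
proof -
  have "finite {i. \<sigma> i \<noteq> 0}"
    using assms by (simp add: G_inf_def)
  then obtain k where "\<forall>i\<in>{i. \<sigma> i \<noteq> 0}. i \<le> k"
    using finite_nat_set_iff_bounded_le by blast
  then have "\<forall>i>k. \<sigma> i = 0"
    by (metis mem_Collect_eq not_less)
  with that show thesis
    by blast
qed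

text \<open>Zero occurs exactly once, as (0, 1), since \<open>coprime 0 n\<close> forces
  \<open>n = 1\<close>.\<close>

definition reduced_fractions :: "(nat \<times> nat) set" where
  "reduced_fractions = {(r, n). r < n \<and> coprime r n}"

text \<open>A pair of naturals from which both \<open>F\<close> and \<open>h\<close> can be read, so
  that one bijection reindexes the whole series.\<close>

definition numden :: "(nat \<Rightarrow> bit) \<Rightarrow> nat \<times> nat" where
  "numden \<sigma> = (rhat (level \<sigma>) (code (level \<sigma>) \<sigma>), hhat (level \<sigma>) (code (level \<sigma>) \<sigma>))"

lemma F_numden: "F \<sigma> = real (fst (numden \<sigma>)) / real (snd (numden \<sigma>))"
  and h_numden: "h \<sigma> = snd (numden \<sigma>)"
  by (simp_all add: F_def F_level_def h_def h_level_def numden_def)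

lemma coprime_fraction_unique:
  fixes a b c d :: nat
  assumes "coprime a b" "coprime c d" "b > 0" "d > 0" "real a / real b = real c / real d"
  shows "(a, b) = (c, d)"
proof -
  have "real (a * d) = real (c * b)"
    using assms by (simp add: field_simps)
  then have "a * d = c * b"
    by (simp only: of_nat_eq_iff)
  then show ?thesis
    using coprime_crossproduct_nat[of a b c d] assms by (simp add: mult.commute)
qed

lemma numden_in: "numden \<sigma> \<in> reduced_fractions"
  unfolding numden_def reduced_fractions_def
  by (simp add: code_less rhat_less_hhat coprime_rhat_hhat)

lemma bij_betw_numden: "bij_betw numden G_inf reduced_fractions"
proof (rule bij_betw_imageI)
  show "inj_on numden G_inf"
  proof (rule inj_onI)
    fix \<sigma> \<tau> assume G: "\<sigma> \<in> G_inf" "\<tau> \<in> G_inf" and eq: "numden \<sigma> = numden \<tau>"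
    obtain k where k: "\<forall>i>k. \<sigma> i = 0"
      using G(1) by (rule G_inf_bounded)
    obtain l where l: "\<forall>i>l. \<tau> i = 0"
      using G(2) by (rule G_inf_bounded)
    \<comment> \<open>Monotonicity in the code holds within a single level, so both words are padded
      with zeros to a common one.\<close>
    define m where "m = max k l"
    have m: "\<forall>i>m. \<sigma> i = 0" "\<forall>i>m. \<tau> i = 0"
      using k l by (simp_all add: m_def)
    have "F_level m \<sigma> = F_level m \<tau>"
      using h_F_eq_level(2)[OF m(1)] h_F_eq_level(2)[OF m(2)] eq by (simp add: F_numden)
    then have "code m \<sigma> = code m \<tau>"
      using rhat_div_hhat_less[of "code m \<sigma>" "code m \<tau>" m]
        rhat_div_hhat_less[of "code m \<tau>" "code m \<sigma>" m] code_less[of m \<sigma>] code_less[of m \<tau>]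
      by (cases "code m \<sigma>" "code m \<tau>" rule: linorder_cases) (auto simp: F_level_def)
    then have "\<sigma> i = \<tau> i" for i
      using code_inj[of m \<sigma> \<tau> i] m G by (cases "i = 0"; cases "i \<le> m") (auto simp: G_inf_def)
    then show "\<sigma> = \<tau>"
      by blast
  qed
next
  show "numden ` G_inf = reduced_fractions"
  proof (intro antisym subsetI)
    fix x assume "x \<in> reduced_fractions"
    then obtain r n where x: "x = (r, n)" "r < n" "coprime r n"
      by (auto simp: reduced_fractions_def)
    then obtain k s where s: "s < 2 ^ k" "rhat k s = r" "hhat k s = n"
      using reduced_fraction_in_array by blast
    obtain \<sigma> where \<sigma>: "\<sigma> 0 = 0" "\<forall>i>k. \<sigma> i = 0" "code k \<sigma> = s"
      using code_surj[OF s(1)] by blast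
    have "{i. \<sigma> i \<noteq> 0} \<subseteq> {..k}"
      using \<sigma>(2) by (auto simp: not_less[symmetric])
    then have "\<sigma> \<in> G_inf"
      using \<sigma>(1) by (auto simp: G_inf_def intro: finite_subset)
    \<comment> \<open>The level \<open>k\<close> may exceed \<open>level \<sigma>\<close>, so the
      comparison goes through \<open>F\<close>, which is independent of the level; a reduced pair is
      determined by its quotient.\<close>
    moreover have "F \<sigma> = real r / real n"
      using h_F_eq_level(2)[OF \<sigma>(2)] s \<sigma>(3) by (simp add: F_level_def)
    then have "numden \<sigma> = (r, n)"
      using coprime_fraction_unique[of "fst (numden \<sigma>)" "snd (numden \<sigma>)" r n] numden_in[of \<sigma>] x
      by (auto simp: F_numden reduced_fractions_def)
    ultimately show "x \<in> numden ` G_inf"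
      using x(1) by force
  qed (use numden_in in blast)
qed

section \<open>Sums over fractions\<close>

definition proper_fractions :: "(nat \<times> nat) set" where
  "proper_fractions = {(a, n). a < n}"

lemma reduced_fractions_subset: "reduced_fractions \<subseteq> proper_fractions"
  by (auto simp: reduced_fractions_def proper_fractions_def)

text \<open>The scaling factor is the gcd of the two entries, which is positive because the
  denominator is.\<close>

lemma bij_betw_scale_fraction:
  "bij_betw (\<lambda>(m, r, n). (m * r, m * n)) ({0<..} \<times> reduced_fractions) proper_fractions"
proof (rule bij_betw_imageI)
  show "inj_on (\<lambda>(m, r, n). (m * r, m * n)) ({0<..} \<times> reduced_fractions)"
  proof (rule inj_onI, clarsimp simp: reduced_fractions_def)
    fix m r n m' r' n' :: nat
    assume A: "m > 0" "coprime r n" "m' > 0" "coprime r' n'" "m * r = m' * r'" "m * n = m' * n'"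
    have "gcd (m * r) (m * n) = m" "gcd (m' * r') (m' * n') = m'"
      using A(2,4) by (simp_all add: gcd_mult_left)
    with A show "m = m' \<and> r = r' \<and> n = n'"
      by auto
  qed
next
  show "(\<lambda>(m, r, n). (m * r, m * n)) ` ({0<..} \<times> reduced_fractions) = proper_fractions"
  proof (intro antisym subsetI)
    fix x assume "x \<in> proper_fractions"
    then obtain a n where x: "x = (a, n)" "a < n"
      by (auto simp: proper_fractions_def)
    define d where "d = gcd a n"
    have d: "d > 0" "d * (a div d) = a" "d * (n div d) = n"
      using x by (auto simp: d_def)
    have "a div d < n div d"
      using x(2) d by (metis mult_less_cancel1)
    moreover have "coprime (a div d) (n div d)"
      using x unfolding d_def by (intro div_gcd_coprime) auto
    ultimately have "(d, a div d, n div d) \<in> {0<..} \<times> reduced_fractions"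
      using d(1) by (simp add: reduced_fractions_def)
    then show "x \<in> (\<lambda>(m, r, n). (m * r, m * n)) ` ({0<..} \<times> reduced_fractions)"
      using x(1) d by (intro image_eqI[of _ _ "(d, a div d, n div d)"]) auto
  qed (auto simp: reduced_fractions_def proper_fractions_def)
qed

lemma riemann_zeta_has_sum:
  assumes "Re s > 1"
  shows "((\<lambda>n. of_nat n powr (- s)) has_sum riemann_zeta s) {0<..}"
proof -
  have "summable (\<lambda>n. norm (of_nat n powr (- s) :: complex))"
    using assms by (simp add: norm_powr_real_powr summable_real_powr_iff)
  then have "summable (\<lambda>n. norm (of_nat (n + 1) powr (- s) :: complex))"
    by (subst (asm) summable_Suc_iff[symmetric]) simp
  \<comment> \<open>Absolute convergence turns the ordered series into an unordered sum; the index
    shift is undone afterwards.\<close>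
  then have "((\<lambda>n. of_nat (n + 1) powr (- s)) has_sum riemann_zeta s) UNIV"
    using riemann_zeta_sums[OF assms] by (rule norm_summable_imp_has_sum)
  then show ?thesis
    by (rule has_sum_reindex_bij_witness[of _ "\<lambda>n. n - 1" "\<lambda>n. n + 1", THEN iffD1, rotated -1]) auto
qed

definition fraction_term :: "complex \<Rightarrow> real \<Rightarrow> nat \<times> nat \<Rightarrow> complex" where
  "fraction_term s t x =
     exp (2 * complex_of_real pi * \<i> * complex_of_real t
            * (1 - complex_of_real (real (fst x) / real (snd x))))
       * of_nat (snd x) powr (- s)"

lemma Z_term_eq_fraction_term: "Z_term s t \<sigma> = fraction_term s t (numden \<sigma>)"
  by (simp add: Z_term_def fraction_term_def F_numden h_numden)

text \<open>The phase depends only on the quotient, so scaling affects the power alone.\<close>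

lemma fraction_term_scale:
  assumes "m > 0"
  shows "fraction_term s t (m * r, m * n) = of_nat m powr (- s) * fraction_term s t (r, n)"
proof -
  have "(of_nat (m * n) :: complex) powr (- s) = of_nat m powr (- s) * of_nat n powr (- s)"
    by (simp add: powr_times_real)
  then show ?thesis
    using assms by (simp add: fraction_term_def)
qed

lemma norm_fraction_term:
  assumes "n > 0"
  shows "norm (fraction_term s t (a, n)) = real n powr (- Re s)"
proof -
  have "norm (exp (2 * complex_of_real pi * \<i> * complex_of_real t
            * (1 - complex_of_real (real a / real n)))) = 1"
    by (simp add: norm_exp_eq_Re)
  then show ?thesis
    unfolding fraction_term_def norm_mult using assms by (simp add: norm_powr_real_powr)
qed

text \<open>Denominator \<open>n\<close> contributes \<open>n\<close> terms of norm
  \<open>n powr (- Re s)\<close>, and the row sums \<open>n powr (1 - Re s)\<close> converge because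
  \<open>Re s > 2\<close>.\<close>

lemma fraction_term_abs_summable:
  assumes "Re s > 2"
  shows "(\<lambda>x. norm (fraction_term s t x)) summable_on proper_fractions"
proof -
  have 1: "((\<lambda>a. norm (fraction_term s t (a, n))) has_sum (real n powr (1 - Re s))) {..<n}"
    if "n \<in> {0<..}" for n
  proof -
    have "n > 0" using that by simp
    then have "(\<Sum>a<n. norm (fraction_term s t (a, n))) = real n powr (1 - Re s)"
      by (simp add: norm_fraction_term powr_diff powr_minus field_simps)
    then show ?thesis
      by (metis finite_lessThan has_sum_finite)
  qed
  have "summable (\<lambda>n. real n powr (1 - Re s))"
    using assms by (simp add: summable_real_powr_iff)
  then have "(\<lambda>n. real n powr (1 - Re s)) summable_on UNIV"
    by (intro summable_nonneg_imp_summable_on) auto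
  then have "(\<lambda>n. real n powr (1 - Re s)) summable_on {0<..}"
    by (rule summable_on_subset_banach) simp
  then have "(\<lambda>(n, a). norm (fraction_term s t (a, n))) summable_on Sigma {0<..} (\<lambda>n. {..<n})"
    using 1 by (intro summable_on_SigmaI[where g = "\<lambda>n. real n powr (1 - Re s)"]) auto
  then show ?thesis
    by (rule summable_on_reindex_bij_witness[of _ "\<lambda>(a, n). (n, a)" "\<lambda>(n, a). (a, n)", THEN iffD1, rotated -1])
      (auto simp: proper_fractions_def)
qed

text \<open>Absolute summability permits grouping by denominator, so only the finite row sums
  \<open>g n\<close> remain to be evaluated.\<close>

lemma has_sum_proper_fractions:
  assumes "Re s > 2" "\<And>n. n > 0 \<Longrightarrow> (\<Sum>a<n. fraction_term s t (a, n)) = g n"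
    and "(g has_sum W) {0<..}"
  shows "(fraction_term s t has_sum W) proper_fractions"
proof -
  have bij: "bij_betw (\<lambda>(n, a). (a, n)) (Sigma {0<..} (\<lambda>n. {..<n})) proper_fractions"
    by (rule bij_betwI[of _ _ _ "\<lambda>(a, n). (n, a)"]) (auto simp: proper_fractions_def)
  have "fraction_term s t summable_on proper_fractions"
    using fraction_term_abs_summable[OF assms(1)] by (rule abs_summable_summable)
  then have S: "(\<lambda>(n, a). fraction_term s t (a, n)) summable_on Sigma {0<..} (\<lambda>n. {..<n})"
    by (subst (asm) summable_on_reindex_bij_betw[OF bij, symmetric]) (simp add: case_prod_unfold)
  have "((\<lambda>(n, a). fraction_term s t (a, n)) has_sum W) (Sigma {0<..} (\<lambda>n. {..<n}))"
  proof (rule has_sum_SigmaI[OF _ assms(3) S])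
    fix n :: nat assume "n \<in> {0<..}"
    then show "((\<lambda>a. case (n, a) of (n, a) \<Rightarrow> fraction_term s t (a, n)) has_sum g n) {..<n}"
      using assms(2)[of n] by (simp add: has_sum_finite_iff)
  qed
  then show ?thesis
    by (subst has_sum_reindex_bij_betw[OF bij, symmetric]) (simp add: case_prod_unfold)
qed

section \<open>The product of the zeta function with \<open>Z\<close>\<close>

lemma Z_term_abs_summable:
  assumes "Re s > 2"
  shows "(\<lambda>\<sigma>. norm (Z_term s t \<sigma>)) summable_on G_inf"
  unfolding Z_term_eq_fraction_term
  using summable_on_reindex_bij_betw[OF bij_betw_numden, of "\<lambda>x. norm (fraction_term s t x)"]
    summable_on_subset_banach[OF fraction_term_abs_summable[OF assms] reduced_fractions_subset]
  by blast

lemma Z_eq_infsum_reduced: "Z s t = infsum (fraction_term s t) reduced_fractions"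
  unfolding Z_def Z_term_eq_fraction_term
  by (rule infsum_reindex_bij_betw[OF bij_betw_numden])

text \<open>The sum over proper fractions is split by the gcd \<open>m\<close>; each slice is
  \<open>of_nat m powr (- s) * Z s t\<close>. A product is stated because
  \<open>riemann_zeta s\<close> is not yet known to be nonzero.\<close>

lemma zeta_times_Z:
  assumes "Re s > 2" "(fraction_term s t has_sum W) proper_fractions"
  shows "riemann_zeta s * Z s t = W"
proof -
  have "fraction_term s t summable_on reduced_fractions"
    using abs_summable_summable[OF fraction_term_abs_summable[OF assms(1)]] reduced_fractions_subset
    by (rule summable_on_subset_banach)
  then have Z: "(fraction_term s t has_sum Z s t) reduced_fractions"
    unfolding Z_eq_infsum_reduced by (rule has_sum_infsum)
  have "((\<lambda>x. fraction_term s t ((\<lambda>(m, r, n). (m * r, m * n)) x)) has_sum W)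
          ({0<..} \<times> reduced_fractions)"
    by (subst has_sum_reindex_bij_betw[OF bij_betw_scale_fraction]) (rule assms(2))
  moreover have "((\<lambda>y. fraction_term s t ((\<lambda>(m, r, n). (m * r, m * n)) (m, y))) has_sum
      of_nat m powr (- s) * Z s t) reduced_fractions" if "m \<in> {0<..}" for m :: nat
    using has_sum_cmult_right[OF Z, of "of_nat m powr (- s)"] that
    by (simp add: case_prod_unfold fraction_term_scale)
  ultimately have "((\<lambda>m. of_nat m powr (- s) * Z s t) has_sum W) {0<..}"
    by (rule has_sum_SigmaD)
  moreover have "((\<lambda>m. of_nat m powr (- s) * Z s t) has_sum riemann_zeta s * Z s t) {0<..}"
    using assms(1) by (intro has_sum_cmult_left riemann_zeta_has_sum) simp
  ultimately show ?thesis
    by (rule has_sum_unique[OF _ _, symmetric])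
qed

section \<open>Sums of roots of unity\<close>

lemma sum_roots_of_unity_fractions:
  assumes "n > 0"
  shows "(\<Sum>a<n. exp (2 * complex_of_real pi * \<i> * (1 - complex_of_real (real a / real n))))
           = (if n = 1 then 1 else 0)"
proof -
  define w where "w = exp (- (2 * complex_of_real pi * \<i> / of_nat n))"
  \<comment> \<open>The constant 1 in the exponent contributes a full turn, leaving a geometric sum
    in \<open>w\<close>.\<close>
  have eq: "exp (2 * complex_of_real pi * \<i> * (1 - complex_of_real (real a / real n))) = w ^ a" for a
  proof -
    have "2 * complex_of_real pi * \<i> * (1 - complex_of_real (real a / real n))
            = 2 * complex_of_real pi * \<i> + of_nat a * (- (2 * complex_of_real pi * \<i> / of_nat n))"
      by (simp add: algebra_simps)
    then show ?thesis
      by (simp only: exp_add exp_of_nat_mult w_def exp_two_pi_i mult_1)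
  qed
  have "w ^ n = exp (- (2 * complex_of_real pi * \<i>))"
    using assms by (simp add: w_def flip: exp_of_nat_mult)
  then have wn: "w ^ n = 1"
    by (simp add: exp_minus exp_two_pi_i)
  have "w \<noteq> 1" if "n > 1"
  proof
    assume "w = 1"
    \<comment> \<open>The exponent would be an integer multiple of a full turn, making
      \<open>1 / n\<close> an integer, which is impossible for \<open>n > 1\<close>.\<close>
    then obtain j :: int where *: "- (2 * pi / real n) = of_int (2 * j) * pi"
      by (auto simp: w_def exp_eq_1)
    then have "real_of_int (- j) * real n = 1"
    proof -
      have "pi * (real_of_int (- j) * real n) = pi * 1"
        using * assms by (simp add: field_simps)
      then show ?thesis
        using pi_gt_zero by (simp only: mult_cancel_left) simp
    qed
    then have "(- j) * int n = 1"
      by (metis of_int_eq_1_iff of_int_mult of_int_of_nat_eq)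
    then have "int n = 1"
      using zmult_eq_1_iff[of "- j" "int n"] by linarith
    then show False
      using that by simp
  qed
  then show ?thesis
    using assms wn by (simp only: eq) (auto simp: geometric_sum)
qed

theorem theorem1p2:
  fixes s :: complex
  assumes "Re s > 2"
  shows "(\<forall>t\<in>{0..1::real}. (\<lambda>\<sigma>. norm (Z_term s t \<sigma>)) summable_on G_inf) \<and>
    Z s 1 = (\<Sum>\<^sub>\<infinity>\<sigma>\<in>G_inf.
       exp (- (2 * complex_of_real pi * \<i> * complex_of_real (F \<sigma>))) * of_nat (h \<sigma>) powr (- s)) \<and>
    Z s 1 = 1 / riemann_zeta s \<and>
    Z s 0 = (\<Sum>\<^sub>\<infinity>\<sigma>\<in>G_inf. of_nat (h \<sigma>) powr (- s)) \<and>
    Z s 0 = riemann_zeta (s - 1) / riemann_zeta s"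
proof -
  have "Z_term s 1 \<sigma> =
      exp (- (2 * complex_of_real pi * \<i> * complex_of_real (F \<sigma>))) * of_nat (h \<sigma>) powr (- s)" for \<sigma>
    by (simp add: Z_term_def right_diff_distrib exp_diff exp_two_pi_i exp_minus field_simps)
  moreover have "Z_term s 0 \<sigma> = of_nat (h \<sigma>) powr (- s)" for \<sigma>
    by (simp add: Z_term_def)
  moreover have Z1: "riemann_zeta s * Z s 1 = 1"
  proof (rule zeta_times_Z[OF assms], rule has_sum_proper_fractions[OF assms])
    \<comment> \<open>The power is constant along a row and equals 1 for \<open>n = 1\<close>, so
      the root of unity sum alone decides the value.\<close>
    show "(\<Sum>a<n. fraction_term s 1 (a, n)) = (if n = 1 then 1 else 0)" if "n > 0" for n
      using sum_roots_of_unity_fractions[OF that]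
      by (simp add: fraction_term_def flip: sum_distrib_right)
    have "((\<lambda>n::nat. if n = 1 then 1 else 0 :: complex) has_sum 1) {1}"
      by (simp add: has_sum_finite_iff)
    then show "((\<lambda>n::nat. if n = 1 then 1 else 0 :: complex) has_sum 1) {0<..}"
      by (rule has_sum_cong_neutral[THEN iffD1, rotated -1]) auto
  qed
  moreover have "riemann_zeta s * Z s 0 = riemann_zeta (s - 1)"
  proof (rule zeta_times_Z[OF assms], rule has_sum_proper_fractions[OF assms])
    \<comment> \<open>At \<open>t = 0\<close> the phase is 1, and the \<open>n\<close> equal terms
      raise the exponent by one.\<close>
    show "(\<Sum>a<n. fraction_term s 0 (a, n)) = of_nat n powr (- (s - 1))" if "n > 0" for n
      using that by (simp add: fraction_term_def powr_diff powr_minus field_simps)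
    show "((\<lambda>n. of_nat n powr (- (s - 1))) has_sum riemann_zeta (s - 1)) {0<..}"
      using assms by (intro riemann_zeta_has_sum) simp
  qed
  moreover have "riemann_zeta s \<noteq> 0"
    using Z1 by auto
  ultimately show ?thesis
    using Z_term_abs_summable[OF assms] by (simp add: Z_def field_simps)
qed

end
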